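(* Let $\mathbf M=(m_1,\dots,m_r)$ be any Motzkin path. Then for every $\alpha\in I_r$ and every $n\in\mathbb Z$ there is a Laurent polynomial $f$ in $2r$ variables with nonnegative integer coefficients such that $$R_{\alpha,n}=f\bigl(R_{1,m_1},\dots,R_{r,m_r},R_{1,m_1+1},\dots,R_{r,m_r+1}\bigr).$$
   Context: Fix $r\ge1$, $I_r=\{1,\dots,r\}$. Let $R_{1,0},\dots,R_{r,0},R_{1,1},\dots,R_{r,1}$ be algebraically independent indeterminates over $\mathbb Q$ and $(R_{\alpha,n})_{0\le\alpha\le r+1,n\in\mathbb Z}$ the $A_r$ $Q$-system: the unique family of nonzero elements of $\mathbb Q(R_{1,0},\dots,R_{r,1})$ with these initial values, $R_{0,n}=R_{r+1,n}=1$, and $R_{\alpha,n+1}R_{\alpha,n-1}=R_{\alpha,n}^2+R_{\alpha+1,n}R_{\alpha-1,n}$ ($\alpha\in I_r$, $n\in\mathbb Z$). A Motzkin path is $\mathbf M=(m_1,\dots,m_r)\in\mathbb Z^r$ with $|m_{\alpha+1}-m_\alpha|\le1$ for $1\le\alpha<r$; the elements $R_{\alpha,m_\alpha},R_{\alpha,m_\alpha+1}$ ($\alpha\in I_r$) then form a set of $2r$ algebraically independent generators of the same field. *)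

theory Defs
  imports Complex_Main "HOL-Library.Poly_Mapping"
begin

definition poly_eval_rat :: "((nat \<Rightarrow>\<^sub>0 nat) \<Rightarrow>\<^sub>0 rat) \<Rightarrow> (nat \<Rightarrow> 'a::field_char_0) \<Rightarrow> 'a" where
  "poly_eval_rat p x = (\<Sum>mn\<in>Poly_Mapping.keys p. of_rat (Poly_Mapping.lookup p mn) * (\<Prod>i\<in>Poly_Mapping.keys mn. x i ^ Poly_Mapping.lookup mn i))"

definition alg_indep_rat :: "nat \<Rightarrow> (nat \<Rightarrow> 'a::field_char_0) \<Rightarrow> bool" where
  "alg_indep_rat N x \<longleftrightarrow>
     (\<forall>p. p \<noteq> 0 \<longrightarrow> (\<forall>mn\<in>Poly_Mapping.keys p. Poly_Mapping.keys mn \<subseteq> {..<N}) \<longrightarrow> poly_eval_rat p x \<noteq> 0)"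

text \<open>Laurent polynomials with nonnegative integer coefficients: finitely supported maps from
  integer exponent vectors to natural-number coefficients.\<close>
type_synonym laurent_nat = "(nat \<Rightarrow>\<^sub>0 int) \<Rightarrow>\<^sub>0 nat"

definition laurent_vars_below :: "nat \<Rightarrow> laurent_nat \<Rightarrow> bool" where
  "laurent_vars_below N f \<longleftrightarrow> (\<forall>mn\<in>Poly_Mapping.keys f. Poly_Mapping.keys mn \<subseteq> {..<N})"

definition laurent_eval :: "laurent_nat \<Rightarrow> (nat \<Rightarrow> 'a::field) \<Rightarrow> 'a" where
  "laurent_eval f x = (\<Sum>mn\<in>Poly_Mapping.keys f. of_nat (Poly_Mapping.lookup f mn) * (\<Prod>i\<in>Poly_Mapping.keys mn. x i powi Poly_Mapping.lookup mn i))"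

definition is_Q_system :: "nat \<Rightarrow> (nat \<Rightarrow> int \<Rightarrow> 'a::field) \<Rightarrow> bool" where
  "is_Q_system r R \<longleftrightarrow>
     (\<forall>n. R 0 n = 1 \<and> R (r + 1) n = 1) \<and>
     (\<forall>\<alpha>\<in>{1..r}. \<forall>n. R \<alpha> n \<noteq> 0) \<and>
     (\<forall>\<alpha>\<in>{1..r}. \<forall>n. R \<alpha> (n + 1) * R \<alpha> (n - 1) = (R \<alpha> n)^2 + R (\<alpha> + 1) n * R (\<alpha> - 1) n)"

definition initial_data :: "nat \<Rightarrow> (nat \<Rightarrow> int \<Rightarrow> 'a) \<Rightarrow> nat \<Rightarrow> 'a" where
  "initial_data r R j = (if j < r then R (j + 1) 0 else R (j - r + 1) 1)"

definition motzkin_path :: "nat \<Rightarrow> (nat \<Rightarrow> int) \<Rightarrow> bool" where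
  "motzkin_path r m \<longleftrightarrow> (\<forall>\<alpha>. 1 \<le> \<alpha> \<and> \<alpha> < r \<longrightarrow> \<bar>m (\<alpha> + 1) - m \<alpha>\<bar> \<le> 1)"

definition motzkin_data :: "nat \<Rightarrow> (nat \<Rightarrow> int) \<Rightarrow> (nat \<Rightarrow> int \<Rightarrow> 'a) \<Rightarrow> nat \<Rightarrow> 'a" where
  "motzkin_data r m R j = (if j < r then R (j + 1) (m (j + 1)) else R (j - r + 1) (m (j - r + 1) + 1))"

end

theory Submission
  imports Defs
begin

text \<open>
  To a Motzkin path \<open>M\<close> we attach a matrix \<open>P = L U\<close> of size \<open>r + 1\<close>, where \<open>L\<close> (lower unitriangular)
  and \<open>U\<close> (upper triangular) are products of elementary matrices, one for each index \<open>i\<close>, whose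
  parameters are Laurent monomials in the data at \<open>M\<close>. The order of the factors with indices \<open>i\<close> and
  \<open>i + 1\<close> depends on the step \<open>m (i + 1) - m i\<close>. The leading minor of order \<open>\<alpha>\<close> of \<open>U\<close> is
  \<open>R \<alpha> (m \<alpha> + 1) / R \<alpha> (m \<alpha>)\<close>, and the \<open>Q\<close>-system says precisely that \<open>U L\<close>, computed at \<open>M\<close>,
  is \<open>L U\<close> computed at the path \<open>M + 1\<close>: this is an LU step of a discrete Toda flow. Hence the leading minor of
  order \<open>\<alpha>\<close> of \<open>P ^ k\<close> is \<open>R \<alpha> (m \<alpha> + k) / R \<alpha> (m \<alpha>)\<close>. All minors of elementary matrices
  are \<open>0\<close> or monomials with positive coefficient, so the minors of \<open>P ^ k\<close> are positive Laurent
  polynomials. Negative \<open>k\<close> is covered by the symmetry \<open>n \<mapsto> - n\<close>.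

  Determinants are avoided by working in the exterior algebra throughout.
\<close>

section \<open>Elementary operators on the exterior algebra\<close>

text \<open>
  The indicator of a set \<open>S\<close> of indices stands for the wedge product of the corresponding basis
  vectors. The operators \<open>opE i u\<close>, \<open>opF i l\<close> and \<open>opH i t\<close> are the actions of
  \<open>1 + u e_(i,i+1)\<close>, of \<open>1 + l e_(i+1,i)\<close> and of the diagonal matrix with entries \<open>t\<close>, \<open>1/t\<close>
  at \<open>i\<close>, \<open>i + 1\<close>. No signs occur because only adjacent indices are exchanged.
\<close>

type_synonym 'a fock = "(nat \<Rightarrow> bool) \<Rightarrow> 'a"

definition opE :: "nat \<Rightarrow> 'a::field \<Rightarrow> 'a fock \<Rightarrow> 'a fock" where
  "opE i u f = (\<lambda>S. f S + (if S i \<and> \<not> S (Suc i) then u * f (S(i := False, Suc i := True)) else 0))"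

definition opF :: "nat \<Rightarrow> 'a::field \<Rightarrow> 'a fock \<Rightarrow> 'a fock" where
  "opF i l f = (\<lambda>S. f S + (if \<not> S i \<and> S (Suc i) then l * f (S(i := True, Suc i := False)) else 0))"

definition opH :: "nat \<Rightarrow> 'a::field \<Rightarrow> 'a fock \<Rightarrow> 'a fock" where
  "opH i t f = (\<lambda>S. (if S i \<and> \<not> S (Suc i) then t else if \<not> S i \<and> S (Suc i) then inverse t else 1) * f S)"

text \<open>For adjacent \<open>i\<close> and \<open>j\<close> both mixed terms vanish: either
  exchange fills or empties the shared index so that the other one is blocked.\<close>

lemma opE_opF_commute:
  assumes "i \<noteq> j"
  shows "opE i u (opF j l f) = opF j l (opE i u f)"
proof -
  consider "j = Suc i" | "i = Suc j" | "j \<noteq> Suc i" "i \<noteq> Suc j" by blast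
  then show ?thesis
  proof cases
    case 3
    have "S(j := True, Suc j := False, i := False, Suc i := True)
        = S(i := False, Suc i := True, j := True, Suc j := False)" for S :: "nat \<Rightarrow> bool"
      using 3 assms by (auto simp: fun_eq_iff)
    then show ?thesis
      using 3 assms by (intro ext) (auto simp: opE_def opF_def algebra_simps)
  qed (auto simp: opE_def opF_def fun_eq_iff)
qed

text \<open>This is the 2x2 factorization of the matrix with rows \<open>(t, u)\<close> and
  \<open>(l, 1)\<close>, of determinant 1, into lower, diagonal and upper factors.\<close>

lemma opE_opF_same:
  assumes "t = 1 + u * l" "t \<noteq> 0"
  shows "opE i u (opF i l f) = opF i (l / t) (opH i t (opE i (u / t) f))"
proof
  fix S :: "nat \<Rightarrow> bool"
  have "S(i := False) = S" if "\<not> S i" using that by (auto simp: fun_eq_iff)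
  moreover have "S(i := True) = S" if "S i" using that by (auto simp: fun_eq_iff)
  moreover have "S(Suc i := False) = S" if "\<not> S (Suc i)" using that by (auto simp: fun_eq_iff)
  moreover have "S(Suc i := True) = S" if "S (Suc i)" using that by (auto simp: fun_eq_iff)
  ultimately have upd: "S i \<Longrightarrow> \<not> S (Suc i) \<Longrightarrow> S(i := True, Suc i := False) = S"
     "\<not> S i \<Longrightarrow> S (Suc i) \<Longrightarrow> S(i := False, Suc i := True) = S"
    by simp_all
  have "f S * t = f S + u * l * f S" by (simp add: assms(1) algebra_simps)
  moreover have "f S = (1 + u * l) * f S / t" using assms by simp
  ultimately show "opE i u (opF i l f) S = opF i (l / t) (opH i t (opE i (u / t) f)) S"
    using assms(2) upd
    by (auto simp: opE_def opF_def opH_def fun_upd_twist[of i "Suc i"] field_simps)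
qed

text \<open>The power of \<open>t\<close> is minus the entry \<open>(j, i)\<close> of the Cartan matrix of type A.\<close>

definition cart :: "nat \<Rightarrow> nat \<Rightarrow> 'a::field \<Rightarrow> 'a" where
  "cart j i t = (if j = i then inverse t ^ 2 else if j = Suc i \<or> i = Suc j then t else 1)"

lemma opH_opF:
  assumes "t \<noteq> 0"
  shows "opH j t (opF i l f) = opF i (l * cart j i t) (opH j t f)"
  using assms
  by (auto simp: opH_def opF_def fun_eq_iff cart_def field_simps power2_eq_square)

lemma opE_opH:
  assumes "t \<noteq> 0"
  shows "opE i u (opH j t f) = opH j t (opE i (u * cart j i t) f)"
  using assms
  by (auto simp: opH_def opE_def fun_eq_iff cart_def field_simps power2_eq_square)

lemma opH_commute: "opH i s (opH j t f) = opH j t (opH i s f)"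
  by (auto simp: opH_def fun_eq_iff)

lemma opH_opH: "opH i s (opH i t f) = opH i (s * t) f"
  by (auto simp: opH_def fun_eq_iff)

section \<open>Exchanging upper and lower Coxeter products\<close>

text \<open>The value \<open>s k\<close> decides on which side of factor \<open>k\<close> the factor
  \<open>Suc k\<close> stands: a down step puts it to the left. In \<open>upperprod\<close> an up
  step does so, hence a step 0 puts both new factors to the right.\<close>

primrec lowerprod :: "(nat \<Rightarrow> int) \<Rightarrow> (nat \<Rightarrow> 'a::field) \<Rightarrow> nat \<Rightarrow> 'a fock \<Rightarrow> 'a fock" where
  "lowerprod s l 0 f = f"
| "lowerprod s l (Suc k) f =
     (if s k = -1 then opF (Suc k) (l (Suc k)) (lowerprod s l k f)
      else lowerprod s l k (opF (Suc k) (l (Suc k)) f))"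

primrec upperprod :: "(nat \<Rightarrow> int) \<Rightarrow> (nat \<Rightarrow> 'a::field) \<Rightarrow> nat \<Rightarrow> 'a fock \<Rightarrow> 'a fock" where
  "upperprod s u 0 f = f"
| "upperprod s u (Suc k) f =
     (if s k = 1 then opE (Suc k) (u (Suc k)) (upperprod s u k f)
      else upperprod s u k (opE (Suc k) (u (Suc k)) f))"

primrec diagprod :: "(nat \<Rightarrow> 'a::field) \<Rightarrow> nat \<Rightarrow> 'a fock \<Rightarrow> 'a fock" where
  "diagprod t 0 f = f"
| "diagprod t (Suc k) f = diagprod t k (opH (Suc k) (t (Suc k)) f)"

section \<open>Moving single factors through ordered products\<close>

lemma lowerprod_cong:
  "(\<And>i. 1 \<le> i \<Longrightarrow> i \<le> k \<Longrightarrow> l i = l' i) \<Longrightarrow> lowerprod s l k f = lowerprod s l' k f"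
  by (induction k arbitrary: f) auto

lemma upperprod_cong:
  "(\<And>i. 1 \<le> i \<Longrightarrow> i \<le> k \<Longrightarrow> u i = u' i) \<Longrightarrow> upperprod s u k f = upperprod s u' k f"
  by (induction k arbitrary: f) auto

lemma diagprod_cong:
  "(\<And>i. 1 \<le> i \<Longrightarrow> i \<le> k \<Longrightarrow> t i = t' i) \<Longrightarrow> diagprod t k f = diagprod t' k f"
  by (induction k arbitrary: f) auto

lemma opE_lowerprod: "k < i \<Longrightarrow> opE i u (lowerprod s l k f) = lowerprod s l k (opE i u f)"
  by (induction k arbitrary: f) (auto simp: opE_opF_commute)

lemma upperprod_opF: "k < i \<Longrightarrow> upperprod s u k (opF i l f) = opF i l (upperprod s u k f)"
  by (induction k arbitrary: f) (auto simp: opE_opF_commute)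

lemma diagprod_opH: "diagprod t k (opH i x f) = opH i x (diagprod t k f)"
  by (induction k arbitrary: f) (auto simp: opH_commute[of _ _ i])

lemma diagprod_diagprod: "diagprod t k (diagprod t' k f) = diagprod (\<lambda>i. t i * t' i) k f"
  by (induction k arbitrary: f) (auto simp: diagprod_opH opH_opH mult.commute)

lemma diagprod_opF:
  assumes "\<And>i. 1 \<le> i \<Longrightarrow> i \<le> k \<Longrightarrow> t i \<noteq> 0"
  shows "diagprod t k (opF i l f) = opF i (l * (\<Prod>j=1..k. cart j i (t j))) (diagprod t k f)"
  using assms
  by (induction k arbitrary: f l) (auto simp: opH_opF mult_ac)

lemma opE_diagprod:
  assumes "\<And>i. 1 \<le> i \<Longrightarrow> i \<le> k \<Longrightarrow> t i \<noteq> 0"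
  shows "opE i u (diagprod t k f) = diagprod t k (opE i (u * (\<Prod>j=1..k. cart j i (t j))) f)"
  using assms
  by (induction k arbitrary: f u) (auto simp: opE_opH mult_ac)

lemma prod_cart_top:
  assumes "t 0 = 1"
  shows "(\<Prod>j=1..k. cart j (Suc k) (t j)) = t k"
proof (cases k)
  case (Suc n)
  have "(\<Prod>j=1..n. cart j (Suc k) (t j)) = 1"
    by (rule prod.neutral) (auto simp: cart_def Suc)
  then show ?thesis by (simp add: Suc cart_def)
qed (simp add: assms)

lemma prod_cart:
  assumes "t 0 = 1" "t (Suc r) = 1" "1 \<le> i" "i \<le> r"
  shows "(\<Prod>j=1..r. cart j i (t j)) = t (i - 1) * t (i + 1) / t i ^ 2"
proof -
  \<comment> \<open>The boundary values make the added factors at \<open>0\<close> and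
    \<open>Suc r\<close> trivial, so both neighbours of \<open>i\<close> always lie in the
    range.\<close>
  have "(\<Prod>j=1..r. cart j i (t j)) = (\<Prod>j\<in>{0..Suc r}. cart j i (t j))"
    by (rule prod.mono_neutral_left)
       (use assms in \<open>auto simp: cart_def le_Suc_eq not_le less_Suc_eq dest: antisym\<close>)
  also have "\<dots> = (\<Prod>j\<in>{i - 1, i, i + 1}. cart j i (t j))"
    by (rule prod.mono_neutral_right) (use assms in \<open>auto simp: cart_def\<close>)
  also have "\<dots> = t (i - 1) * t (i + 1) / t i ^ 2"
    using assms by (cases i) (auto simp: cart_def field_simps)
  finally show ?thesis .
qed

text \<open>Among the indices up to \<open>k\<close> only \<open>k\<close> is a neighbour of
  \<open>Suc k\<close>, so only its parameter is rescaled.\<close>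

lemma upperprod_opH_top:
  assumes "x \<noteq> 0"
  shows "upperprod s u k (opH (Suc k) x f) = opH (Suc k) x (upperprod s (u(k := u k * x)) k f)"
proof (cases k)
  case (Suc n)
  have far: "upperprod s v n (opH (Suc (Suc n)) x g) = opH (Suc (Suc n)) x (upperprod s v n g)" for v g
  proof -
    have "j \<le> n \<Longrightarrow> upperprod s v j (opH (Suc (Suc n)) x g) = opH (Suc (Suc n)) x (upperprod s v j g)" for j
      by (induction j arbitrary: g) (auto simp: opE_opH assms cart_def)
    then show ?thesis by simp
  qed
  have "upperprod s (u(Suc n := y)) n g = upperprod s u n g" for y g
    by (rule upperprod_cong) auto
  then show ?thesis
    by (auto simp: Suc far opE_opH assms cart_def)
qed simp

lemma opH_top_lowerprod:
  assumes "x \<noteq> 0"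
  shows "opH (Suc k) x (lowerprod s l k f) = lowerprod s (l(k := l k * x)) k (opH (Suc k) x f)"
proof (cases k)
  case (Suc n)
  have far: "opH (Suc (Suc n)) x (lowerprod s v n g) = lowerprod s v n (opH (Suc (Suc n)) x g)" for v g
  proof -
    have "j \<le> n \<Longrightarrow> opH (Suc (Suc n)) x (lowerprod s v j g) = lowerprod s v j (opH (Suc (Suc n)) x g)" for j
      by (induction j arbitrary: g) (auto simp: opH_opF assms cart_def)
    then show ?thesis by simp
  qed
  have "lowerprod s (l(Suc n := y)) n g = lowerprod s l n g" for y g
    by (rule lowerprod_cong) auto
  then show ?thesis
    by (auto simp: Suc far opH_opF assms cart_def)
qed simp

text \<open>Division by \<open>t i\<close> comes from the 2x2 exchange. The diagonal factors are
  gathered between the lower and the upper product, and a neighbouring value of \<open>t\<close>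
  enters when its diagonal factor crosses factor \<open>i\<close> on the way there.\<close>

definition swapped_lower :: "(nat \<Rightarrow> int) \<Rightarrow> (nat \<Rightarrow> 'a::field) \<Rightarrow> (nat \<Rightarrow> 'a) \<Rightarrow> nat \<Rightarrow> 'a" where
  "swapped_lower s t l i =
     l i / t i * (if s (i - 1) = -1 then 1 else t (i - 1)) * (if s i = -1 then t (i + 1) else 1)"

definition swapped_upper :: "(nat \<Rightarrow> int) \<Rightarrow> (nat \<Rightarrow> 'a::field) \<Rightarrow> (nat \<Rightarrow> 'a) \<Rightarrow> nat \<Rightarrow> 'a" where
  "swapped_upper s t u i =
     u i / t i * (if s (i - 1) = 1 then t (i - 1) else 1) * (if s i = 1 then 1 else t (i + 1))"

text \<open>The 2x2 exchange is applied once for each index. The relation for \<open>t i\<close>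
  contains the parameters that the two factors of index \<open>i\<close> have when they meet, after
  rescaling by diagonal factors already produced.\<close>

lemma upperprod_lowerprod_swap:
  assumes "t 0 = 1" "t (Suc k) = 1" "\<And>i. 1 \<le> i \<Longrightarrow> i \<le> k \<Longrightarrow> t i \<noteq> 0"
    and "\<And>i. 1 \<le> i \<Longrightarrow> i \<le> k \<Longrightarrow>
      t i = 1 + u i * l i * (if s (i - 1) = 1 then t (i - 1) else 1) * (if s i = -1 then t (i + 1) else 1)"
  shows "upperprod s u k (lowerprod s l k f)
       = lowerprod s (swapped_lower s t l) k (diagprod t k (upperprod s (swapped_upper s t u) k f))"
  using assms
proof (induction k arbitrary: u t f)
  case 0
  then show ?case by simp
next
  case (Suc k)
  \<comment> \<open>The statement for \<open>k\<close> needs \<open>t (Suc k) = 1\<close>, so it is applied to \<open>t'\<close>; on a down step the factor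
    \<open>x\<close> missing from the relation at \<open>k\<close> is moved into \<open>u k\<close>.\<close>
  define x where "x = t (Suc k)"
  define t' where "t' = t(Suc k := 1)"
  have x: "x \<noteq> 0" using Suc.prems(3) by (simp add: x_def)
  have tnz: "t i \<noteq> 0" if "1 \<le> i" "i \<le> k" for i using Suc.prems(3) that by simp
  have t'nz: "t' i \<noteq> 0" if "1 \<le> i" "i \<le> k" for i using tnz that by (simp add: t'_def)
  have t'0: "t' 0 = 1" "t' (Suc k) = 1" using Suc.prems by (simp_all add: t'_def)
  have xeq: "x = 1 + u (Suc k) * l (Suc k) * (if s k = 1 then t k else 1)"
    using Suc.prems(4)[of "Suc k"] Suc.prems(2) by (simp add: x_def split: if_splits)
  have rel: "t i = 1 + u i * l i * (if s (i - 1) = 1 then t (i - 1) else 1) * (if s i = -1 then t (i + 1) else 1)"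
    if "1 \<le> i" "i \<le> k" for i using Suc.prems(4) that by simp
  have diag: "diagprod t' k g = diagprod t k g" for g
    by (rule diagprod_cong) (simp add: t'_def)
  have dF: "diagprod t k (opF (Suc k) y g) = opF (Suc k) (y * t k) (diagprod t k g)" for y g
    using diagprod_opF[of k t] tnz prod_cart_top[of t k] Suc.prems(1) by simp
  have dE: "opE (Suc k) y (diagprod t k g) = diagprod t k (opE (Suc k) (y * t k) g)" for y g
    using opE_diagprod[of k t] tnz prod_cart_top[of t k] Suc.prems(1) by simp
  have low: "lowerprod s (swapped_lower s t' l) k g = lowerprod s (swapped_lower s t l) k g"
    if "s k \<noteq> -1" for g
    by (rule lowerprod_cong) (use that in \<open>auto simp: swapped_lower_def t'_def\<close>)
  have topl: "swapped_lower s t l (Suc k) = l (Suc k) / x * (if s k = -1 then 1 else t k)"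
    using Suc.prems(2) by (simp add: swapped_lower_def x_def)
  have topu: "swapped_upper s t u (Suc k) = u (Suc k) / x * (if s k = 1 then t k else 1)"
    using Suc.prems(2) by (simp add: swapped_upper_def x_def)
  show ?case
  proof (cases "s k = -1")
    case True
    define u' where "u' = u(k := u k * x)"
    have IH: "upperprod s u' k (lowerprod s l k g) = lowerprod s (swapped_lower s t' l) k
        (diagprod t' k (upperprod s (swapped_upper s t' u') k g))" for g
    proof (rule Suc.IH[OF t'0 t'nz])
      fix i assume i: "1 \<le> i" "i \<le> k"
      show "t' i = 1 + u' i * l i * (if s (i - 1) = 1 then t' (i - 1) else 1)
          * (if s i = -1 then t' (i + 1) else 1)"
        using rel[OF i] i True by (cases "i = k") (auto simp: t'_def u'_def x_def mult_ac)
    qed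
    have 1: "upperprod s (swapped_upper s t' u') k g = upperprod s (swapped_upper s t u) k g" for g
      by (rule upperprod_cong)
         (use True in \<open>auto simp: swapped_upper_def t'_def u'_def x_def\<close>)
    have 2: "lowerprod s ((swapped_lower s t' l)(k := swapped_lower s t' l k * x)) k g
        = lowerprod s (swapped_lower s t l) k g" for g
      by (rule lowerprod_cong)
         (use True in \<open>auto simp: swapped_lower_def t'_def x_def\<close>)
    \<comment> \<open>On a down step the two new factors are adjacent in the middle. They are
      exchanged first, then the upper one leaves to the right and the lower one to the left.\<close>
    have "upperprod s u (Suc k) (lowerprod s l (Suc k) f)
        = upperprod s u k (opE (Suc k) (u (Suc k)) (opF (Suc k) (l (Suc k)) (lowerprod s l k f)))"
      using True by simp
    also have "\<dots> = opF (Suc k) (l (Suc k) / x) (opH (Suc k) x (upperprod s u' k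
        (lowerprod s l k (opE (Suc k) (u (Suc k) / x) f))))"
      using opE_opF_same[of x "u (Suc k)" "l (Suc k)"] xeq x True
      by (simp add: upperprod_opF opE_lowerprod upperprod_opH_top u'_def)
    also have "\<dots> = opF (Suc k) (l (Suc k) / x) (lowerprod s (swapped_lower s t l) k
        (diagprod t k (opH (Suc k) x (upperprod s (swapped_upper s t u) k
        (opE (Suc k) (u (Suc k) / x) f)))))"
      by (simp only: IH 1 2 opH_top_lowerprod[OF x] diag diagprod_opH)
    finally show ?thesis using True topl topu by (simp add: x_def)
  next
    case False
    \<comment> \<open>Without a down step the relation at \<open>k\<close> does not involve
      \<open>t (Suc k)\<close>, so the induction hypothesis applies with \<open>u\<close>
      unchanged.\<close>
    have IH: "upperprod s u k (lowerprod s l k g) = lowerprod s (swapped_lower s t l) k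
        (diagprod t k (upperprod s (swapped_upper s t' u) k g))" for g
      unfolding low[OF False, symmetric] diag[symmetric]
    proof (rule Suc.IH[OF t'0 t'nz])
      fix i assume i: "1 \<le> i" "i \<le> k"
      show "t' i = 1 + u i * l i * (if s (i - 1) = 1 then t' (i - 1) else 1)
          * (if s i = -1 then t' (i + 1) else 1)"
        using rel[OF i] i False by (cases "i = k") (auto simp: t'_def)
    qed
    show ?thesis
    proof (cases "s k = 1")
      case True
      have 1: "upperprod s (swapped_upper s t' u) k g = upperprod s (swapped_upper s t u) k g" for g
        by (rule upperprod_cong) (use True in \<open>auto simp: swapped_upper_def t'_def\<close>)
      \<comment> \<open>On an up step the new factors stand at the two outer ends. The lower one
        picks up \<open>t k\<close> from the diagonal part before they meet.\<close>
      have "upperprod s u (Suc k) (lowerprod s l (Suc k) f)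
        = opE (Suc k) (u (Suc k)) (lowerprod s (swapped_lower s t l) k (diagprod t k
            (upperprod s (swapped_upper s t u) k (opF (Suc k) (l (Suc k)) f))))"
        using True by (simp add: IH 1)
      also have "\<dots> = lowerprod s (swapped_lower s t l) k (opE (Suc k) (u (Suc k))
          (opF (Suc k) (l (Suc k) * t k) (diagprod t k (upperprod s (swapped_upper s t u) k f))))"
        by (simp add: upperprod_opF opE_lowerprod dF)
      also have "\<dots> = lowerprod s (swapped_lower s t l) k (opF (Suc k) (l (Suc k) * t k / x)
          (opH (Suc k) x (diagprod t k (opE (Suc k) (u (Suc k) / x * t k)
          (upperprod s (swapped_upper s t u) k f)))))"
        using opE_opF_same[of x "u (Suc k)" "l (Suc k) * t k"] xeq x True
        by (simp add: dE mult.assoc)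
      finally show ?thesis using True topl topu
        by (simp add: x_def diagprod_opH)
    next
      case False': False
      have 1: "upperprod s ((swapped_upper s t' u)(k := swapped_upper s t' u k * x)) k g
          = upperprod s (swapped_upper s t u) k g" for g
        by (rule upperprod_cong) (use False' in \<open>auto simp: swapped_upper_def t'_def x_def\<close>)
      have "upperprod s u (Suc k) (lowerprod s l (Suc k) f)
        = upperprod s u k (lowerprod s l k (opE (Suc k) (u (Suc k)) (opF (Suc k) (l (Suc k)) f)))"
        using False False' by (simp add: opE_lowerprod)
      also have "\<dots> = lowerprod s (swapped_lower s t l) k (opF (Suc k) (l (Suc k) / x * t k)
         (diagprod t k (opH (Suc k) x (upperprod s (swapped_upper s t u) k
         (opE (Suc k) (u (Suc k) / x) f)))))"
      proof -
        have "opE (Suc k) (u (Suc k)) (opF (Suc k) (l (Suc k)) f)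
            = opF (Suc k) (l (Suc k) / x) (opH (Suc k) x (opE (Suc k) (u (Suc k) / x) f))"
          by (rule opE_opF_same) (use xeq x False' in auto)
        then show ?thesis
          using x by (simp add: IH upperprod_opF dF upperprod_opH_top 1)
      qed
      finally show ?thesis using False False' topl topu by (simp add: x_def)
    qed
  qed
qed

lemma diagprod_lowerprod:
  assumes "c 0 = 1" "c (Suc r) = 1" "\<And>i. 1 \<le> i \<Longrightarrow> i \<le> r \<Longrightarrow> c i \<noteq> 0"
  shows "diagprod c r (lowerprod s l r f)
       = lowerprod s (\<lambda>i. l i * (c (i - 1) * c (i + 1) / c i ^ 2)) r (diagprod c r f)"
proof -
  have step: "diagprod c r (opF i y g) = opF i (y * (c (i - 1) * c (i + 1) / c i ^ 2)) (diagprod c r g)"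
    if "1 \<le> i" "i \<le> r" for i y g
    using diagprod_opF[of r c] prod_cart[of c r i] assms that by simp
  have "k \<le> r \<Longrightarrow> diagprod c r (lowerprod s l k f)
       = lowerprod s (\<lambda>i. l i * (c (i - 1) * c (i + 1) / c i ^ 2)) k (diagprod c r f)" for k
    by (induction k arbitrary: f) (auto simp: step)
  then show ?thesis by simp
qed

section \<open>The operators attached to a Motzkin path\<close>

definition steps :: "(nat \<Rightarrow> int) \<Rightarrow> nat \<Rightarrow> int" where
  "steps m i = m (Suc i) - m i"

definition ratio :: "(nat \<Rightarrow> int \<Rightarrow> 'a::field) \<Rightarrow> (nat \<Rightarrow> int) \<Rightarrow> nat \<Rightarrow> 'a" where
  "ratio R m i = R i (m i + 1) / R i (m i)"

text \<open>
  The weights are the solution of the recursions \<open>u' = swapped_upper s t u\<close> and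
  \<open>l' i = swapped_lower s t l i * c (i - 1) * c (i + 1) / c i ^ 2\<close> along the shift \<open>M \<mapsto> M + 1\<close>,
  where \<open>c = ratio R m\<close> and \<open>t\<close> is the quotient of the ratios at \<open>M + 1\<close> and at \<open>M\<close>.
\<close>

definition upper_weight :: "(nat \<Rightarrow> int \<Rightarrow> 'a::field) \<Rightarrow> (nat \<Rightarrow> int) \<Rightarrow> nat \<Rightarrow> 'a" where
  "upper_weight R m i = inverse (ratio R m i)
     * (if steps m (i - 1) = 1 then ratio R m (i - 1) else 1)
     * (if steps m i = 1 then 1 else ratio R m (i + 1))"

definition lower_weight :: "(nat \<Rightarrow> int \<Rightarrow> 'a::field) \<Rightarrow> (nat \<Rightarrow> int) \<Rightarrow> nat \<Rightarrow> 'a" where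
  "lower_weight R m i = R (i - 1) (m (i - 1)) * R (i + 1) (m (i + 1)) * inverse (R i (m i)) ^ 2
     * inverse (ratio R m i)
     * (if steps m (i - 1) = -1 then 1 else ratio R m (i - 1))
     * (if steps m i = -1 then ratio R m (i + 1) else 1)"

definition lower_op :: "nat \<Rightarrow> (nat \<Rightarrow> int \<Rightarrow> 'a::field) \<Rightarrow> (nat \<Rightarrow> int) \<Rightarrow> 'a fock \<Rightarrow> 'a fock" where
  "lower_op r R m f = lowerprod (steps m) (lower_weight R m) r f"

definition upper_op :: "nat \<Rightarrow> (nat \<Rightarrow> int \<Rightarrow> 'a::field) \<Rightarrow> (nat \<Rightarrow> int) \<Rightarrow> 'a fock \<Rightarrow> 'a fock" where
  "upper_op r R m f = diagprod (ratio R m) r (upperprod (steps m) (upper_weight R m) r f)"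

lemma Q_system_boundary:
  assumes "is_Q_system r R"
  shows "R 0 n = 1" "R (Suc r) n = 1"
  using assms by (auto simp: is_Q_system_def)

lemma Q_system_nonzero:
  assumes "is_Q_system r R" "i \<le> Suc r"
  shows "R i n \<noteq> 0"
proof -
  consider "i = 0" | "i = Suc r" | "1 \<le> i" "i \<le> r" using assms(2) by linarith
  then show ?thesis using assms(1) by cases (auto simp: is_Q_system_def)
qed

text \<open>The shift keeps all steps, hence the order of the factors. The relation required for the
  exchange is the \<open>Q\<close>-system relation at \<open>n = m i + 1\<close>, divided by the
  square of \<open>R i (m i + 1)\<close>.\<close>

lemma upper_op_lower_op:
  fixes R :: "nat \<Rightarrow> int \<Rightarrow> 'a::field"
  assumes Q: "is_Q_system r R" and path: "\<And>i. i \<le> r \<Longrightarrow> \<bar>steps m i\<bar> \<le> 1"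
  shows "upper_op r R m (lower_op r R m f)
       = lower_op r R (\<lambda>i. m i + 1) (upper_op r R (\<lambda>i. m i + 1) f)"
proof -
  define m' where "m' = (\<lambda>i. m i + 1)"
  define c where "c = ratio R m"
  define c' where "c' = ratio R m'"
  define t where "t i = c' i / c i" for i
  have steps: "steps m' = steps m" by (auto simp: steps_def m'_def fun_eq_iff)
  note nz = Q_system_nonzero[OF Q]
  have cnz: "c i \<noteq> 0" "c' i \<noteq> 0" if "i \<le> Suc r" for i
    using nz[OF that] by (simp_all add: c_def c'_def ratio_def)
  have bd: "c 0 = 1" "c (Suc r) = 1" "t 0 = 1" "t (Suc r) = 1"
    using Q_system_boundary[OF Q] by (simp_all add: t_def c_def c'_def ratio_def)
  have tnz: "t i \<noteq> 0" if "i \<le> Suc r" for i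
    using cnz[OF that] by (simp add: t_def)
  have rel: "t i = 1 + upper_weight R m i * lower_weight R m i
      * (if steps m (i - 1) = 1 then t (i - 1) else 1) * (if steps m i = -1 then t (i + 1) else 1)"
    if i: "1 \<le> i" "i \<le> r" for i
  proof -
    obtain j where j: "i = Suc j" using i by (cases i) auto
    have Qi: "R i (m i + 2) * R i (m i) = (R i (m i + 1))\<^sup>2 + R (Suc i) (m i + 1) * R j (m i + 1)"
      using Q i unfolding is_Q_system_def j
      by (auto dest!: bspec[of _ _ i] spec[of _ "m i + 1"] simp: j add.assoc)
    have nz3: "R j n \<noteq> 0" "R i n \<noteq> 0" "R (Suc i) n \<noteq> 0" for n
      using nz i j by auto
    \<comment> \<open>The neighbour is read at \<open>m j\<close>, \<open>m j + 1\<close> or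
      \<open>m j + 2\<close>, depending on the step; \<open>c j\<close> and \<open>c j * t j\<close>
      are its two successive ratios.\<close>
    have low: "R j (m i + 1) = R j (m j) *
        (if steps m j = -1 then 1 else c j) * (if steps m j = 1 then c j * t j else 1)"
    proof -
      consider "steps m j = 1" | "steps m j = 0" | "steps m j = -1"
        using path[of j] i j by fastforce
      then show ?thesis
      proof cases
        case 1
        then have "m i = m j + 1" by (simp add: steps_def j)
        then show ?thesis using 1 nz3
          by (simp add: c_def c'_def t_def ratio_def m'_def)
      next
        case 2
        then have "m i = m j" by (simp add: steps_def j)
        then show ?thesis using 2 nz3 by (simp add: c_def ratio_def)
      next
        case 3
        then have "m i + 1 = m j" by (simp add: steps_def j)
        then show ?thesis using 3 by simp
      qed
    qed
    have up: "R (Suc i) (m i + 1) = R (Suc i) (m (Suc i)) *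
        (if steps m i = 1 then 1 else c (Suc i)) * (if steps m i = -1 then c (Suc i) * t (Suc i) else 1)"
    proof -
      consider "steps m i = 1" | "steps m i = 0" | "steps m i = -1"
        using path[of i] i by fastforce
      then show ?thesis
      proof cases
        case 1
        then have "m i + 1 = m (Suc i)" by (simp add: steps_def)
        then show ?thesis using 1 by simp
      next
        case 2
        then have "m i = m (Suc i)" by (simp add: steps_def)
        then show ?thesis using 2 nz3 by (simp add: c_def ratio_def)
      next
        case 3
        then have "m i = m (Suc i) + 1" by (simp add: steps_def)
        then show ?thesis using 3 nz3
          by (simp add: c_def c'_def t_def ratio_def m'_def)
      qed
    qed
    have "t i = R i (m i + 2) * R i (m i) / (R i (m i + 1))\<^sup>2"
      using nz3 by (simp add: t_def c_def c'_def ratio_def m'_def power2_eq_square add.assoc)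
    also have "\<dots> = 1 + R j (m i + 1) * R (Suc i) (m i + 1) / (R i (m i + 1))\<^sup>2"
      unfolding Qi using nz3 by (simp add: add_divide_distrib mult.commute)
    also have "R j (m i + 1) * R (Suc i) (m i + 1) / (R i (m i + 1))\<^sup>2
       = R j (m i + 1) * R (Suc i) (m i + 1) * inverse (R i (m i)) ^ 2 * inverse (c i) ^ 2"
      using nz3 by (simp add: c_def ratio_def field_simps)
    also have "\<dots> = upper_weight R m i * lower_weight R m i
      * (if steps m (i - 1) = 1 then t (i - 1) else 1) * (if steps m i = -1 then t (i + 1) else 1)"
      unfolding low up upper_weight_def lower_weight_def c_def[symmetric]
      by (auto simp: j power2_eq_square mult_ac)
    finally show ?thesis .
  qed
  have upw: "swapped_upper (steps m) t (upper_weight R m) i = upper_weight R m' i"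
    if i: "1 \<le> i" "i \<le> r" for i
    using cnz[of i] cnz[of "i - 1"] cnz[of "i + 1"] i
    unfolding swapped_upper_def upper_weight_def steps c_def[symmetric] c'_def[symmetric] t_def
    by (auto simp: field_simps)
  have low: "swapped_lower (steps m) t (lower_weight R m) i * (c (i - 1) * c (i + 1) / c i ^ 2)
       = lower_weight R m' i"
    if i: "1 \<le> i" "i \<le> r" for i
  proof -
    have shift: "R j (m' j) = R j (m j) * c j" if "j \<le> Suc r" for j
      using nz[OF that] by (simp add: c_def ratio_def m'_def)
    have "R (i - 1) (m' (i - 1)) = R (i - 1) (m (i - 1)) * c (i - 1)"
      "R i (m' i) = R i (m i) * c i" "R (i + 1) (m' (i + 1)) = R (i + 1) (m (i + 1)) * c (i + 1)"
      using i by (auto intro!: shift)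
    then show ?thesis
      using cnz[of i] cnz[of "i - 1"] cnz[of "i + 1"] i
      unfolding swapped_lower_def lower_weight_def steps c_def[symmetric] c'_def[symmetric] t_def
      by (auto simp: field_simps)
  qed
  have "upper_op r R m (lower_op r R m f)
      = diagprod c r (lowerprod (steps m) (swapped_lower (steps m) t (lower_weight R m)) r
          (diagprod t r (upperprod (steps m) (swapped_upper (steps m) t (upper_weight R m)) r f)))"
    unfolding upper_op_def lower_op_def c_def[symmetric]
    by (rule arg_cong[where f = "diagprod c r"], rule upperprod_lowerprod_swap[OF bd(3,4)])
       (simp add: tnz, rule rel)
  also have "\<dots> = lowerprod (steps m) (lower_weight R m') r (diagprod c r
          (diagprod t r (upperprod (steps m) (swapped_upper (steps m) t (upper_weight R m)) r f)))"
    by (subst diagprod_lowerprod) (use bd cnz low in \<open>auto intro!: lowerprod_cong\<close>)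
  also have "\<dots> = lowerprod (steps m) (lower_weight R m') r (diagprod c r
          (diagprod t r (upperprod (steps m) (upper_weight R m') r f)))"
    using upperprod_cong[of r, OF upw] by simp
  also have "\<dots> = lower_op r R m' (upper_op r R m' f)"
    unfolding diagprod_diagprod lower_op_def upper_op_def steps c'_def[symmetric]
    using diagprod_cong[of r "\<lambda>i. c i * t i" c'] cnz by (simp add: t_def)
  finally show ?thesis by (simp add: m'_def)
qed

section \<open>Leading minors as matrix elements\<close>

definition init_seg :: "nat \<Rightarrow> nat \<Rightarrow> bool" where
  "init_seg \<alpha> = (\<lambda>i. 1 \<le> i \<and> i \<le> \<alpha>)"

text \<open>A multiple of the highest weight vector, the wedge of the first \<alpha> basis vectors;
  its diagonal matrix element is the leading minor of order \<alpha>.\<close>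

definition state :: "nat \<Rightarrow> 'a::field \<Rightarrow> 'a fock" where
  "state \<alpha> x = (\<lambda>S. if S = init_seg \<alpha> then x else 0)"

text \<open>An exchange needs \<open>i\<close> outside and \<open>Suc i\<close> inside the segment.
  Since the segment starts at 1, this could happen only for \<open>i = 0\<close>.\<close>

lemma opF_init_seg: "1 \<le> i \<Longrightarrow> opF i l f (init_seg \<alpha>) = f (init_seg \<alpha>)"
  by (auto simp: opF_def init_seg_def)

lemma lowerprod_init_seg: "lowerprod s l k f (init_seg \<alpha>) = f (init_seg \<alpha>)"
  by (induction k arbitrary: f) (auto simp: opF_init_seg)

lemma opE_state:
  assumes "1 \<le> i"
  shows "opE i u (state \<alpha> x) = state \<alpha> x"
proof -
  have "S(i := False, Suc i := True) \<noteq> init_seg \<alpha>" for S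
  proof
    assume eq: "S(i := False, Suc i := True) = init_seg \<alpha>"
    show False using fun_cong[OF eq, of i] fun_cong[OF eq, of "Suc i"] assms
      by (auto simp: init_seg_def)
  qed
  then show ?thesis by (intro ext) (simp add: opE_def state_def)
qed

lemma upperprod_state: "upperprod s u k (state \<alpha> x) = state \<alpha> x"
  by (induction k) (auto simp: opE_state)

text \<open>Only the diagonal factor of index \<alpha> meets the segment in exactly one of its two
  indices.\<close>

lemma diagprod_state:
  assumes "1 \<le> \<alpha>"
  shows "diagprod c k (state \<alpha> x) = state \<alpha> (if \<alpha> \<le> k then c \<alpha> * x else x)"
proof (induction k arbitrary: x)
  case 0
  then show ?case using assms by simp
next
  case (Suc k)
  have "opH (Suc k) (c (Suc k)) (state \<alpha> x) = state \<alpha> (if \<alpha> = Suc k then c \<alpha> * x else x)"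
  proof
    fix S
    show "opH (Suc k) (c (Suc k)) (state \<alpha> x) S = state \<alpha> (if \<alpha> = Suc k then c \<alpha> * x else x) S"
    proof (cases "S = init_seg \<alpha>")
      case True
      then have "S i \<longleftrightarrow> 1 \<le> i \<and> i \<le> \<alpha>" for i by (simp add: init_seg_def)
      then show ?thesis using True assms by (auto simp: opH_def state_def)
    qed (simp add: opH_def state_def)
  qed
  then show ?case by (auto simp: Suc.IH)
qed

text \<open>Since \<open>(L U)^(k+1) = L (U L)^k U\<close> and \<open>U L\<close> is
  \<open>L U\<close> at the shifted path, a power is traded for a shift. The outer \<open>L\<close>
  does not change the coefficient at the segment, the outer \<open>U\<close> contributes the ratio
  at \<alpha>, and the ratios telescope.\<close>

lemma Q_system_matrix_element:
  fixes R :: "nat \<Rightarrow> int \<Rightarrow> 'a::field"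
  assumes Q: "is_Q_system r R" and path: "\<And>i. i \<le> r \<Longrightarrow> \<bar>steps m i\<bar> \<le> 1"
    and \<alpha>: "1 \<le> \<alpha>" "\<alpha> \<le> r"
  shows "((\<lambda>f. lower_op r R m (upper_op r R m f)) ^^ k) (state \<alpha> x) (init_seg \<alpha>)
       = x * R \<alpha> (m \<alpha> + int k) / R \<alpha> (m \<alpha>)"
  using path
proof (induction k arbitrary: m x)
  case 0
  then show ?case using Q_system_nonzero[OF Q, of \<alpha>] \<alpha> by (simp add: state_def)
next
  case (Suc k)
  define T where "T m = (\<lambda>f. lower_op r R m (upper_op r R m f))" for m
  define m' where "m' = (\<lambda>i. m i + 1)"
  have path': "\<bar>steps m' i\<bar> \<le> 1" if "i \<le> r" for i
    using Suc.prems[OF that] by (simp add: steps_def m'_def)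
  have inter: "(T m ^^ k) (lower_op r R m g) = lower_op r R m ((T m' ^^ k) g)" for g
    by (induction k) (simp_all add: T_def m'_def upper_op_lower_op[OF Q Suc.prems])
  have "(T m ^^ Suc k) (state \<alpha> x) (init_seg \<alpha>)
      = (T m ^^ k) (lower_op r R m (upper_op r R m (state \<alpha> x))) (init_seg \<alpha>)"
    by (simp only: funpow_Suc_right comp_apply T_def)
  also have "\<dots> = (T m' ^^ k) (state \<alpha> (ratio R m \<alpha> * x)) (init_seg \<alpha>)"
    unfolding inter
    using \<alpha> by (simp add: lower_op_def lowerprod_init_seg upper_op_def upperprod_state diagprod_state)
  also have "\<dots> = ratio R m \<alpha> * x * R \<alpha> (m' \<alpha> + int k) / R \<alpha> (m' \<alpha>)"
    unfolding T_def by (rule Suc.IH[OF path'])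
  also have "\<dots> = x * R \<alpha> (m \<alpha> + int (Suc k)) / R \<alpha> (m \<alpha>)"
    using Q_system_nonzero[OF Q, of \<alpha>] \<alpha>
    by (simp add: ratio_def m'_def add.assoc)
  finally show ?case by (simp add: T_def)
qed

section \<open>Positivity\<close>

text \<open>Positivity becomes closure under sums and products: the operators need no subtraction,
  and inverses occur only inside their parameters.\<close>

locale subsemiring =
  fixes A :: "'a::field set"
  assumes zero: "0 \<in> A" and one: "1 \<in> A"
    and add: "x \<in> A \<Longrightarrow> y \<in> A \<Longrightarrow> x + y \<in> A"
    and mult: "x \<in> A \<Longrightarrow> y \<in> A \<Longrightarrow> x * y \<in> A"
begin

lemma opE_closed: "u \<in> A \<Longrightarrow> (\<And>S. f S \<in> A) \<Longrightarrow> opE i u f S \<in> A"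
  by (auto simp: opE_def intro: add mult)

lemma opF_closed: "l \<in> A \<Longrightarrow> (\<And>S. f S \<in> A) \<Longrightarrow> opF i l f S \<in> A"
  by (auto simp: opF_def intro: add mult)

lemma opH_closed: "t \<in> A \<Longrightarrow> inverse t \<in> A \<Longrightarrow> (\<And>S. f S \<in> A) \<Longrightarrow> opH i t f S \<in> A"
  by (auto simp: opH_def intro: mult)

lemma lowerprod_closed:
  "(\<And>i. 1 \<le> i \<Longrightarrow> i \<le> k \<Longrightarrow> l i \<in> A) \<Longrightarrow> (\<And>S. f S \<in> A) \<Longrightarrow> lowerprod s l k f S \<in> A"
proof (induction k arbitrary: f S)
  case (Suc k)
  then have "opF (Suc k) (l (Suc k)) g S \<in> A" if "\<And>S. g S \<in> A" for g S
    using that by (intro opF_closed) auto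
  then show ?case using Suc by simp
qed simp

lemma upperprod_closed:
  "(\<And>i. 1 \<le> i \<Longrightarrow> i \<le> k \<Longrightarrow> u i \<in> A) \<Longrightarrow> (\<And>S. f S \<in> A) \<Longrightarrow> upperprod s u k f S \<in> A"
proof (induction k arbitrary: f S)
  case (Suc k)
  then have "opE (Suc k) (u (Suc k)) g S \<in> A" if "\<And>S. g S \<in> A" for g S
    using that by (intro opE_closed) auto
  then show ?case using Suc by simp
qed simp

lemma diagprod_closed:
  "(\<And>i. 1 \<le> i \<Longrightarrow> i \<le> k \<Longrightarrow> t i \<in> A \<and> inverse (t i) \<in> A) \<Longrightarrow> (\<And>S. f S \<in> A) \<Longrightarrow> diagprod t k f S \<in> A"
proof (induction k arbitrary: f S)
  case (Suc k)
  then have "opH (Suc k) (t (Suc k)) f S \<in> A" for S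
    by (intro opH_closed) auto
  then show ?case using Suc by simp
qed simp

lemma Q_system_forward_closed:
  assumes Q: "is_Q_system r R" and path: "motzkin_path r m"
    and gen: "\<And>i. i \<in> {1..r} \<Longrightarrow> R i (m i) \<in> A \<and> inverse (R i (m i)) \<in> A
        \<and> R i (m i + 1) \<in> A \<and> inverse (R i (m i + 1)) \<in> A"
    and \<alpha>: "\<alpha> \<in> {1..r}"
  shows "R \<alpha> (m \<alpha> + int k) \<in> A"
proof -
  \<comment> \<open>\<open>m 0\<close> and \<open>m (r + 1)\<close> are unconstrained; constant continuation keeps all steps in \<open>{-1, 0, 1}\<close>.\<close>
  define p where "p i = (if i = 0 then m 1 else if i = Suc r then m r else m i)" for i
  have pm: "p i = m i" if "i \<in> {1..r}" for i using that by (simp add: p_def)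
  have path': "\<bar>steps p i\<bar> \<le> 1" if "i \<le> r" for i
    using path that \<alpha> unfolding motzkin_path_def steps_def p_def
    by (cases "i = 0"; cases "i = r") auto
  have gen': "R i (p i) \<in> A \<and> inverse (R i (p i)) \<in> A
        \<and> R i (p i + 1) \<in> A \<and> inverse (R i (p i + 1)) \<in> A" if i: "i \<le> Suc r" for i
  proof -
    consider "i = 0" | "i = Suc r" | "1 \<le> i" "i \<le> r" using i by linarith
    then show ?thesis
      by cases (use gen pm Q_system_boundary[OF Q] one in auto)
  qed
  have ratio: "ratio R p i \<in> A \<and> inverse (ratio R p i) \<in> A" if "i \<le> Suc r" for i
    using gen'[OF that] by (auto simp: ratio_def divide_inverse intro: mult)
  have up: "upper_weight R p i \<in> A" if "1 \<le> i" "i \<le> r" for i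
    unfolding upper_weight_def using that by (auto intro!: mult one simp: ratio)
  have low: "lower_weight R p i \<in> A" if "1 \<le> i" "i \<le> r" for i
    unfolding lower_weight_def power2_eq_square
    using that by (auto intro!: mult one simp: ratio gen')
  define T where "T = (\<lambda>f. lower_op r R p (upper_op r R p f))"
  have step: "T f S \<in> A" if "\<And>S. f S \<in> A" for f S
    unfolding T_def lower_op_def upper_op_def
    by (intro lowerprod_closed diagprod_closed upperprod_closed)
       (use that low up ratio in auto)
  \<comment> \<open>Starting with \<open>R \<alpha> (p \<alpha>)\<close> instead of 1 cancels the
    denominator of the matrix element.\<close>
  have "(T ^^ k) (state \<alpha> (R \<alpha> (p \<alpha>))) S \<in> A" for S
  proof (induction k arbitrary: S)
    case 0
    then show ?case using gen'[of \<alpha>] \<alpha> zero by (simp add: state_def)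
  qed (simp add: step)
  moreover have "(T ^^ k) (state \<alpha> (R \<alpha> (p \<alpha>))) (init_seg \<alpha>) = R \<alpha> (p \<alpha> + int k)"
    unfolding T_def
    using Q_system_matrix_element[OF Q path', of \<alpha> k "R \<alpha> (p \<alpha>)"] \<alpha> Q_system_nonzero[OF Q, of \<alpha>]
    by simp
  ultimately show ?thesis using pm[OF \<alpha>] by metis
qed

lemma Q_system_closed:
  assumes Q: "is_Q_system r R" and path: "motzkin_path r m"
    and gen: "\<And>i. i \<in> {1..r} \<Longrightarrow> R i (m i) \<in> A \<and> inverse (R i (m i)) \<in> A
        \<and> R i (m i + 1) \<in> A \<and> inverse (R i (m i + 1)) \<in> A"
    and \<alpha>: "\<alpha> \<in> {1..r}"
  shows "R \<alpha> n \<in> A"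
proof (cases "m \<alpha> \<le> n")
  case True
  then show ?thesis
    using Q_system_forward_closed[OF assms, of "nat (n - m \<alpha>)"] by simp
next
  case False
  \<comment> \<open>Time reversal preserves the \<open>Q\<close>-system and sends the pair
    \<open>m i\<close>, \<open>m i + 1\<close> to \<open>- m i - 1\<close>, \<open>- m i\<close>.
    The reflected path therefore has the same data with the two halves exchanged.\<close>
  define R' where "R' i k = R i (- k)" for i k
  define m' where "m' i = - m i - 1" for i
  have "R i (- (k + 1)) * R i (- (k - 1)) = (R i (- k))\<^sup>2 + R (i + 1) (- k) * R (i - 1) (- k)"
    if "i \<in> {1..r}" for i k
  proof -
    have "R i (- k + 1) * R i (- k - 1) = (R i (- k))\<^sup>2 + R (i + 1) (- k) * R (i - 1) (- k)"
      using Q that unfolding is_Q_system_def by blast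
    then show ?thesis by (simp add: mult.commute)
  qed
  then have Q': "is_Q_system r R'"
    using Q unfolding is_Q_system_def R'_def by auto
  have path': "motzkin_path r m'"
    using path by (auto simp: motzkin_path_def m'_def abs_minus_commute)
  have gen': "R' i (m' i) \<in> A \<and> inverse (R' i (m' i)) \<in> A
        \<and> R' i (m' i + 1) \<in> A \<and> inverse (R' i (m' i + 1)) \<in> A" if "i \<in> {1..r}" for i
    using gen[OF that] by (simp add: R'_def m'_def add.commute)
  have "R' \<alpha> (m' \<alpha> + int (nat (- n - m' \<alpha>))) \<in> A"
    by (rule Q_system_forward_closed[OF Q' path' gen' \<alpha>])
  then show ?thesis using False by (simp add: R'_def m'_def)
qed

end

section \<open>Values of positive Laurent polynomials\<close>

definition laurent_monom :: "(nat \<Rightarrow>\<^sub>0 int) \<Rightarrow> (nat \<Rightarrow> 'a::field) \<Rightarrow> 'a" where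
  "laurent_monom e x = (\<Prod>i\<in>Poly_Mapping.keys e. x i powi Poly_Mapping.lookup e i)"

lemma laurent_monom_superset:
  assumes "finite I" "Poly_Mapping.keys e \<subseteq> I"
  shows "laurent_monom e x = (\<Prod>i\<in>I. x i powi Poly_Mapping.lookup e i)"
  unfolding laurent_monom_def
  by (rule prod.mono_neutral_left) (use assms in \<open>auto simp: in_keys_iff\<close>)

text \<open>Nonzero values are needed for adding integer exponents: at 0, the powers with exponents
  1 and -1 multiply to 0, not to 1.\<close>

lemma laurent_monom_add:
  assumes "Poly_Mapping.keys d \<subseteq> {..<N}" "Poly_Mapping.keys e \<subseteq> {..<N}" "\<And>i. i < N \<Longrightarrow> x i \<noteq> 0"
  shows "laurent_monom (d + e) x = laurent_monom d x * laurent_monom e x"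
proof -
  have "Poly_Mapping.keys (d + e) \<subseteq> {..<N}"
    using assms(1,2) Poly_Mapping.keys_add[of d e] by blast
  then show ?thesis
    using assms by (simp add: laurent_monom_superset[of "{..<N}"] lookup_add power_int_add prod.distrib)
qed

lemma laurent_eval_superset:
  assumes "finite K" "Poly_Mapping.keys f \<subseteq> K"
  shows "laurent_eval f x = (\<Sum>e\<in>K. of_nat (Poly_Mapping.lookup f e) * laurent_monom e x)"
  unfolding laurent_eval_def laurent_monom_def
  by (rule sum.mono_neutral_left) (use assms in \<open>auto simp: in_keys_iff\<close>)

lemma laurent_eval_add: "laurent_eval (f + g) x = laurent_eval f x + laurent_eval g x"
  by (simp add: laurent_eval_superset[of "Poly_Mapping.keys f \<union> Poly_Mapping.keys g"]
      Poly_Mapping.keys_add lookup_add distrib_right sum.distrib)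

lemma laurent_eval_single: "laurent_eval (Poly_Mapping.single e 1) x = laurent_monom e x"
  using laurent_eval_superset[of "{e}" "Poly_Mapping.single e 1" x] by simp

text \<open>Adding one monomial at a time, with repetitions, yields all natural coefficients.
  Closure under products then follows by induction, without multiplying the polynomials
  themselves.\<close>

inductive_set laurent_values :: "nat \<Rightarrow> (nat \<Rightarrow> 'a::field) \<Rightarrow> 'a set" for N x where
  zero: "0 \<in> laurent_values N x"
| add_monom: "Poly_Mapping.keys e \<subseteq> {..<N} \<Longrightarrow> y \<in> laurent_values N x
    \<Longrightarrow> laurent_monom e x + y \<in> laurent_values N x"

lemma laurent_values_eval:
  "y \<in> laurent_values N x \<Longrightarrow> \<exists>f. laurent_vars_below N f \<and> y = laurent_eval f x"
proof (induction rule: laurent_values.induct)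
  case zero
  show ?case by (rule exI[of _ 0]) (simp add: laurent_vars_below_def laurent_eval_def)
next
  case (add_monom e y)
  then obtain f where f: "laurent_vars_below N f" "y = laurent_eval f x" by blast
  have "laurent_vars_below N (Poly_Mapping.single e 1 + f)"
    using f(1) add_monom.hyps(1) Poly_Mapping.keys_add[of "Poly_Mapping.single e 1" f]
    by (fastforce simp: laurent_vars_below_def)
  moreover have "laurent_monom e x + y = laurent_eval (Poly_Mapping.single e 1 + f) x"
    unfolding laurent_eval_add laurent_eval_single f(2) ..
  ultimately show ?case by blast
qed

lemma laurent_monom_in_values:
  "Poly_Mapping.keys e \<subseteq> {..<N} \<Longrightarrow> laurent_monom e x \<in> laurent_values N x"
  using laurent_values.add_monom[OF _ laurent_values.zero, of e N x] by simp

lemma laurent_values_add: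
  "y \<in> laurent_values N x \<Longrightarrow> z \<in> laurent_values N x \<Longrightarrow> y + z \<in> laurent_values N x"
  by (induction rule: laurent_values.induct) (simp_all add: add.assoc laurent_values.add_monom)

lemma laurent_values_mult:
  assumes nz: "\<And>i. i < N \<Longrightarrow> x i \<noteq> 0"
    and "y \<in> laurent_values N x" and z: "z \<in> laurent_values N x"
  shows "y * z \<in> laurent_values N x"
proof -
  have monom: "laurent_monom d x * z \<in> laurent_values N x" if d: "Poly_Mapping.keys d \<subseteq> {..<N}" for d
    using z
  proof (induction rule: laurent_values.induct)
    case (add_monom e y)
    have "Poly_Mapping.keys (d + e) \<subseteq> {..<N}"
      using d add_monom.hyps(1) Poly_Mapping.keys_add[of d e] by blast
    then show ?case
      using add_monom.IH laurent_monom_add[OF d add_monom.hyps(1) nz]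
      by (auto simp: distrib_left dest: laurent_values.add_monom)
  qed (simp add: laurent_values.zero)
  show ?thesis using assms(2)
    by (induction rule: laurent_values.induct)
       (auto simp: distrib_right laurent_values.zero intro: laurent_values_add monom)
qed

lemma subsemiring_laurent_values:
  assumes "\<And>i. i < N \<Longrightarrow> x i \<noteq> 0"
  shows "subsemiring (laurent_values N x)"
proof
  show "1 \<in> laurent_values N x"
    using laurent_monom_in_values[of 0 N x] by (simp add: laurent_monom_def)
qed (simp_all add: laurent_values.zero laurent_values_add laurent_values_mult assms)

lemma laurent_values_variable:
  assumes "i < N"
  shows "x i \<in> laurent_values N x" "inverse (x i) \<in> laurent_values N x"
  using laurent_monom_in_values[of "Poly_Mapping.single i 1" N x]
    laurent_monom_in_values[of "Poly_Mapping.single i (-1)" N x] assms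
  by (simp_all add: laurent_monom_def power_int_minus)

theorem mainTheorem14:
  fixes r :: nat and R :: "nat \<Rightarrow> int \<Rightarrow> 'a::field_char_0" and m :: "nat \<Rightarrow> int"
  assumes "r \<ge> 1"
    and "alg_indep_rat (2 * r) (initial_data r R)"
    and "is_Q_system r R"
    and "motzkin_path r m"
  shows "\<forall>\<alpha>\<in>{1..r}. \<forall>n::int. \<exists>f::laurent_nat.
           laurent_vars_below (2 * r) f \<and> R \<alpha> n = laurent_eval f (motzkin_data r m R)"
proof (intro ballI allI)
  fix \<alpha> and n :: int assume \<alpha>: "\<alpha> \<in> {1..r}"
  define x where "x = motzkin_data r m R"
  have "x j \<noteq> 0" if "j < 2 * r" for j
    using that Q_system_nonzero[OF assms(3)] by (simp add: x_def motzkin_data_def)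
  then interpret subsemiring "laurent_values (2 * r) x"
    by (rule subsemiring_laurent_values)
  have "R \<alpha> n \<in> laurent_values (2 * r) x"
  proof (rule Q_system_closed[OF assms(3,4) _ \<alpha>])
    fix i assume i: "i \<in> {1..r}"
    \<comment> \<open>Variables are numbered from 0 and path indices from 1, hence the offset by one
      in both halves.\<close>
    have "x (i - 1) = R i (m i)" "x (r + i - 1) = R i (m i + 1)"
      using i by (auto simp: x_def motzkin_data_def)
    moreover have "i - 1 < 2 * r" "r + i - 1 < 2 * r" using i by auto
    ultimately show "R i (m i) \<in> laurent_values (2 * r) x \<and> inverse (R i (m i)) \<in> laurent_values (2 * r) x
        \<and> R i (m i + 1) \<in> laurent_values (2 * r) x \<and> inverse (R i (m i + 1)) \<in> laurent_values (2 * r) x"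
      using laurent_values_variable[of _ "2 * r" x] by metis
  qed
  then show "\<exists>f. laurent_vars_below (2 * r) f \<and> R \<alpha> n = laurent_eval f (motzkin_data r m R)"
    using laurent_values_eval x_def by blast
qed

end
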